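(* The following statements hold, where $\lambda$ denotes Lebesgue measure and $x_+:=\max(0,x)$. (i) Let $b\colon[0,1]\to[0,\infty)$ be a nondecreasing function which is not $\lambda$-constant. Then the conditional expectation $\mathsf{E}\big(b(1-|T_p|)\,\big|\,|T_p|<1\big)$ is strictly decreasing in $p\in(0,\infty]$. (ii) Let $b\colon[0,\infty)\to[0,\infty)$ be a bounded nondecreasing function which is not $\lambda$-constant. Then $\mathsf{E}\big(b(|T_p|-1)\,\big|\,|T_p|>1\big)$ is strictly decreasing in $p\in(0,\infty]$. (iii) Let $a\colon[0,1]\to[0,\infty)$ be a bounded Borel function with $a(0)=0$. Let $r\colon[0,1]\to[0,\infty)$ be a nondecreasing function which is not $\lambda$-constant on the set $\{t\in[0,1]\colon a(t)\ne0\}$. Let $b:=ra$ (pointwise product). Then the ratio $$\frac{\mathsf{E}\,b\big((1-|T_p|)_+\big)}{\mathsf{E}\,a\big((1-|T_p|)_+\big)}$$ is strictly decreasing in $p\in(0,\infty]$. (iv) Let $a\colon[0,\infty)\to[0,\infty)$ be a bounded Borel function with $a(0)=0$. Let $r\colon[0,\infty)\to[0,\infty)$ be a bounded nondecreasing function which is not $\lambda$-constant on the set $\{t\in[0,\infty)\colon a(t)\ne0\}$. Let $b:=ra$ (pointwise product). Then the ratio $$\frac{\mathsf{E}\,b\big((|T_p|-1)_+\big)}{\mathsf{E}\,a\big((|T_p|-1)_+\big)}$$ is strictly decreasing in $p\in(0,\infty]$.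
   Context: For real $p>0$, Student's distribution with $p$ degrees of freedom (any positive real $p$) has density $$f_p(x):=\frac{\Gamma\left(\frac{p+1}{2}\right)}{\sqrt{\pi p}\,\Gamma\left(\frac p2\right)}\left(1+\frac{x^2}{p}\right)^{-(p+1)/2},\quad x\in\mathbb{R},$$ and, by continuity, $f_\infty$ is the standard normal density. For $p\in(0,\infty]$, $T_p$ denotes any random variable with density $f_p$; in particular, $T_\infty$ is standard normal. Given a Borel set $E$ and a real-valued Borel function $h$ defined on a set containing $E$, $h$ is said to be $\lambda$-constant on $E$ if $\lambda(\{x\in E\colon h(x)\ne\ell\})=0$ for some $\ell\in\mathbb{R}$. If $h$ is not $\lambda$-constant on its domain of definition, $h$ is simply said to be not $\lambda$-constant. *)

theory Defs
  imports "HOL-Probability.Probability"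
begin

text \<open>
  Density of Student's distribution with \<open>p\<close> degrees of freedom; the parameter range
  \<open>(0,\<infinity>]\<close> is rendered as the positive part of \<^typ>\<open>ereal\<close>.  The value is meaningful only for
  \<open>0 < p\<close>.
\<close>

definition student_density :: "ereal \<Rightarrow> real \<Rightarrow> real" where
  "student_density p x =
     (if p = \<infinity> then std_normal_density x
      else let q = real_of_ereal p in
        Gamma ((q + 1) / 2) / (sqrt (pi * q) * Gamma (q / 2))
          * (1 + x\<^sup>2 / q) powr (- (q + 1) / 2))"

text \<open>
  \<open>h\<close> is \<open>\<lambda>\<close>-constant on \<open>E\<close>.  The notion is intended for Borel \<open>E\<close> and \<open>h\<close> Borel on \<open>E\<close>, so that the
  exceptional set is Borel.
\<close>

definition lambda_constant_on :: "real set \<Rightarrow> (real \<Rightarrow> real) \<Rightarrow> bool" where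
  "lambda_constant_on E h \<longleftrightarrow> (\<exists>l. {x \<in> E. h x \<noteq> l} \<in> null_sets lborel)"

text \<open>
  Elementary conditional expectation \<open>E(X | A) = E(X 1\<^sub>A) / P(A)\<close> given an event \<open>A\<close>.  The set integral
  ignores the values of \<open>X\<close> outside \<open>A\<close>, where \<open>X\<close> need not be meaningful or even measurable.
\<close>

definition expectation_given :: "'a measure \<Rightarrow> ('a \<Rightarrow> real) \<Rightarrow> 'a set \<Rightarrow> real" where
  "expectation_given M X A = set_lebesgue_integral M A X / measure M A"

end

theory Submission
  imports Defs
begin

text \<open>
  For \<open>p < q\<close> the logarithmic derivative of \<open>f\<^sub>q / f\<^sub>p\<close> as a function of \<open>s = x\<^sup>2\<close> has the sign of \<open>(q - p) (1 - s)\<close>,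
  so the likelihood ratio increases in \<open>\<bar>x\<bar>\<close> on \<open>[0, 1]\<close> and decreases on \<open>[1, \<infinity>)\<close>.  In each of the four
  cases, passing from \<open>p\<close> to \<open>q\<close> therefore tilts a weighted mean of a nondecreasing function of
  \<open>(1 - \<bar>x\<bar>)\<^sub>+\<close> or \<open>(\<bar>x\<bar> - 1)\<^sub>+\<close> by an oppositely ordered factor, which lowers it by Chebyshev's
  association inequality.  Parts (i) and (ii) are parts (iii) and (iv) with \<open>a\<close> the indicator of \<open>t \<noteq> 0\<close>.
\<close>

section \<open>Chebyshev's association inequality for tilted means\<close>

text \<open>With \<open>m\<close> the \<open>w\<close>-mean of \<open>\<rho>\<close>, the function
  \<open>w x * (m - \<rho> x)\<close> has integral zero, so shifting \<open>R\<close> by a constant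
  does not change the integral of \<open>w x * (m - \<rho> x) * R x\<close>, and a suitable shift
  makes the integrand nonnegative. It cannot vanish almost everywhere: where \<open>w\<close> is
  nonzero, \<open>\<rho>\<close> equals \<open>m\<close> only on a null set, and \<open>R\<close> is
  not almost everywhere constant there.\<close>

lemma tilted_weighted_mean_less:
  fixes w \<rho> R :: "'a \<Rightarrow> real"
  assumes int_w: "integrable M w" and int_w\<rho>: "integrable M (\<lambda>x. w x * \<rho> x)"
    and int_wR: "integrable M (\<lambda>x. w x * R x)" and int_w\<rho>R: "integrable M (\<lambda>x. w x * \<rho> x * R x)"
    and w_nonneg: "\<And>x. 0 \<le> w x" and \<rho>_pos: "\<And>x. 0 < \<rho> x"
    and R_bounds: "\<And>x. l \<le> R x" "\<And>x. R x \<le> u"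
    and opposite: "\<And>x y. w x \<noteq> 0 \<Longrightarrow> w y \<noteq> 0 \<Longrightarrow> \<rho> x < \<rho> y \<Longrightarrow> R y \<le> R x"
    and no_atoms: "\<And>m. AE x in M. w x \<noteq> 0 \<longrightarrow> \<rho> x \<noteq> m"
    and not_const: "\<And>c. \<not> (AE x in M. w x \<noteq> 0 \<longrightarrow> R x = c)"
  shows "(\<integral>x. w x * \<rho> x * R x \<partial>M) / (\<integral>x. w x * \<rho> x \<partial>M) < (\<integral>x. w x * R x \<partial>M) / (\<integral>x. w x \<partial>M)"
proof -
  \<comment> \<open>If \<open>w\<close> vanished almost everywhere, \<open>R\<close> would vacuously
    be constant where \<open>w\<close> is nonzero; so \<open>not_const\<close> also makes both
    denominators positive.\<close>
  have pos: "0 < (\<integral>x. v x \<partial>M)"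
    if "integrable M v" "\<And>x. 0 \<le> v x" "\<And>x. v x = 0 \<longleftrightarrow> w x = 0" for v :: "'a \<Rightarrow> real"
  proof -
    have "\<not> (AE x in M. v x = 0)"
    proof
      assume "AE x in M. v x = 0"
      then have "AE x in M. w x \<noteq> 0 \<longrightarrow> R x = 0" by eventually_elim (simp add: that(3))
      with not_const show False by blast
    qed
    then have "(\<integral>x. v x \<partial>M) \<noteq> 0"
      using integral_nonneg_eq_0_iff_AE[of M v] that by auto
    moreover have "0 \<le> (\<integral>x. v x \<partial>M)" using that by (intro integral_nonneg_AE) auto
    ultimately show ?thesis by simp
  qed
  have W: "0 < (\<integral>x. w x \<partial>M)" by (rule pos) (use int_w w_nonneg in auto)
  have W\<rho>: "0 < (\<integral>x. w x * \<rho> x \<partial>M)"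
    by (rule pos) (use int_w\<rho> w_nonneg \<rho>_pos in \<open>auto simp: less_imp_le less_imp_neq[symmetric] order.strict_implies_not_eq\<close>)
  define m where "m = (\<integral>x. w x * \<rho> x \<partial>M) / (\<integral>x. w x \<partial>M)"
  have mW: "m * (\<integral>x. w x \<partial>M) = (\<integral>x. w x * \<rho> x \<partial>M)" using W by (simp add: m_def)
  define H where "H = R ` {x. w x \<noteq> 0 \<and> m < \<rho> x}"
  \<comment> \<open>A threshold \<open>r\<close> such that \<open>R - r\<close> and \<open>m - \<rho>\<close> never have opposite signs turns the
    inequality into \<open>0 < \<integral> w (R - r) (m - \<rho>)\<close>, since \<open>w (m - \<rho>)\<close> has integral \<open>0\<close>.\<close>
  obtain r where above: "\<And>x. w x \<noteq> 0 \<Longrightarrow> m < \<rho> x \<Longrightarrow> R x \<le> r"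
    and below: "\<And>x. w x \<noteq> 0 \<Longrightarrow> \<rho> x < m \<Longrightarrow> r \<le> R x"
  proof (cases "H = {}")
    \<comment> \<open>Here \<open>above\<close> is vacuous, and the lower bound \<open>l\<close>
      meets \<open>below\<close>.\<close>
    case True
    then show ?thesis using R_bounds(1) by (intro that[of l]) (auto simp: H_def)
  next
    case False
    have bdd: "bdd_above H" using R_bounds(2) by (auto simp: H_def bdd_above_def)
    show ?thesis
    proof (rule that[of "Sup H"])
      show "R x \<le> Sup H" if "w x \<noteq> 0" "m < \<rho> x" for x
        using that bdd by (intro cSup_upper) (auto simp: H_def)
      \<comment> \<open>Every element of \<open>H\<close> is a value of \<open>R\<close> at a point
        with larger \<open>\<rho>\<close>, so \<open>opposite\<close> bounds it by
        \<open>R x\<close>.\<close>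
      show "Sup H \<le> R x" if "w x \<noteq> 0" "\<rho> x < m" for x
        using False that by (intro cSup_least) (auto simp: H_def intro!: opposite)
    qed
  qed
  define h where "h x = w x * ((R x - r) * (m - \<rho> x))" for x
  have h_eq: "h = (\<lambda>x. m * (w x * R x) - w x * \<rho> x * R x - r * m * w x + r * (w x * \<rho> x))"
    by (auto simp: h_def algebra_simps)
  have int_h: "integrable M h"
    unfolding h_eq using assms(1-4)
    by (intro Bochner_Integration.integrable_add Bochner_Integration.integrable_diff integrable_mult_right)
  have "(\<integral>x. h x \<partial>M) = m * (\<integral>x. w x * R x \<partial>M) - (\<integral>x. w x * \<rho> x * R x \<partial>M)
      - r * (m * (\<integral>x. w x \<partial>M)) + r * (\<integral>x. w x * \<rho> x \<partial>M)"
    unfolding h_eq using assms(1-4) by simp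
  then have integral_h: "(\<integral>x. h x \<partial>M) = m * (\<integral>x. w x * R x \<partial>M) - (\<integral>x. w x * \<rho> x * R x \<partial>M)"
    by (simp add: mW)
  have h_nonneg: "0 \<le> h x" for x
  proof (cases "w x = 0")
    case False
    then have "0 \<le> (R x - r) * (m - \<rho> x)"
      using above[of x] below[of x] by (cases "\<rho> x" m rule: linorder_cases)
        (auto intro: mult_nonneg_nonneg mult_nonpos_nonpos)
    then show ?thesis using w_nonneg by (simp add: h_def)
  qed (simp add: h_def)
  have "\<not> (AE x in M. h x = 0)"
  proof
    assume "AE x in M. h x = 0"
    with no_atoms[of m] have "AE x in M. w x \<noteq> 0 \<longrightarrow> R x = r"
      by eventually_elim (auto simp: h_def)
    with not_const show False by blast
  qed
  then have "(\<integral>x. h x \<partial>M) \<noteq> 0"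
    using integral_nonneg_eq_0_iff_AE[OF int_h] h_nonneg by auto
  moreover have "0 \<le> (\<integral>x. h x \<partial>M)" by (intro integral_nonneg_AE) (simp add: h_nonneg)
  ultimately have "(\<integral>x. w x * \<rho> x * R x \<partial>M) < m * (\<integral>x. w x * R x \<partial>M)"
    using integral_h by simp
  then show ?thesis using W W\<rho> by (simp add: m_def field_simps)
qed

section \<open>The likelihood ratio of two Student densities\<close>

lemma student_density_pos: "0 < p \<Longrightarrow> 0 < student_density p x"
proof (cases p)
  case (real q)
  assume "0 < p"
  then have q: "0 < q" using real by simp
  then have "0 < 1 + x\<^sup>2 / q" by (intro add_pos_nonneg) auto
  then show ?thesis using q real by (auto simp: student_density_def Let_def intro!: mult_pos_pos divide_pos_pos Gamma_real_pos)
qed (auto simp: student_density_def normal_density_pos)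

text \<open>The logarithm of the density relative to its value at 0, as a function of
  \<open>s = x\<^sup>2\<close>; the variable \<open>s\<close> makes the derivative a simple rational
  function.\<close>

definition student_exponent :: "ereal \<Rightarrow> real \<Rightarrow> real" where
  "student_exponent p s =
     (if p = \<infinity> then - s / 2
      else let q = real_of_ereal p in - (q + 1) / 2 * ln (1 + s / q))"

definition student_exponent_deriv :: "ereal \<Rightarrow> real \<Rightarrow> real" where
  "student_exponent_deriv p s =
     (if p = \<infinity> then - 1 / 2
      else let q = real_of_ereal p in - (q + 1) / (2 * (q + s)))"

text \<open>The normalising constant is the density at 0, where the power equals 1. Factoring it out
  means that Gamma values for different parameters never have to be compared.\<close>

lemma student_density_eq_exp:
  assumes "0 < p"
  shows "student_density p x = student_density p 0 * exp (student_exponent p (x\<^sup>2))"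
proof (cases p)
  case (real q)
  then have "0 < q" using assms by simp
  then have "0 < 1 + x\<^sup>2 / q" by (intro add_pos_nonneg) auto
  then show ?thesis using real
    by (simp add: student_density_def student_exponent_def powr_def)
qed (use assms in \<open>auto simp: student_density_def student_exponent_def normal_density_def\<close>)

lemma student_exponent_has_deriv:
  assumes "0 < p" "0 \<le> s"
  shows "(student_exponent p has_real_derivative student_exponent_deriv p s) (at s)"
proof (cases p)
  case (real q)
  then have q: "0 < q" using assms by simp
  then have pos: "0 < 1 + s / q" using assms by (intro add_pos_nonneg) auto
  have "((\<lambda>s. ln (1 + s / q)) has_real_derivative 1 / q / (1 + s / q)) (at s)"
    using pos q by (auto intro!: derivative_eq_intros)
  then have "((\<lambda>s. - (q + 1) / 2 * ln (1 + s / q)) has_real_derivative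
      - (q + 1) / 2 * (1 / q / (1 + s / q))) (at s)"
    by (rule DERIV_cmult)
  also have "- (q + 1) / 2 * (1 / q / (1 + s / q)) = - (q + 1) / (2 * (q + s))"
    using q assms by (simp add: field_simps)
  finally show ?thesis
    using real by (simp add: student_exponent_def[abs_def] student_exponent_deriv_def)
next
  case PInf
  have "((\<lambda>s::real. - s / 2) has_real_derivative - 1 / 2) (at s)"
    by (auto intro!: derivative_eq_intros)
  then show ?thesis using PInf by (simp add: student_exponent_def[abs_def] student_exponent_deriv_def)
qed (use assms in auto)

text \<open>The difference of the derivatives is
  \<open>(q - p) * (1 - s) / (2 * (p + s) * (q + s))\<close> for finite \<open>q\<close>, and
  \<open>(1 - s) / (2 * (p + s))\<close> for \<open>q = \<infinity>\<close>; \<open>p\<close> is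
  finite because \<open>p < q\<close>. The sign changes at \<open>s = 1\<close> for every pair of
  parameters, which is why a single cut at \<open>\<bar>x\<bar> = 1\<close> serves them all.\<close>

lemma student_exponent_deriv_less:
  assumes "0 < p" "p < q" "0 \<le> s"
  shows "s < 1 \<Longrightarrow> student_exponent_deriv p s < student_exponent_deriv q s"
    and "1 < s \<Longrightarrow> student_exponent_deriv q s < student_exponent_deriv p s"
proof -
  obtain p' where p: "p = ereal p'" "0 < p'" using assms by (cases p) auto
  have "(s < 1 \<longrightarrow> student_exponent_deriv p s < student_exponent_deriv q s) \<and>
      (1 < s \<longrightarrow> student_exponent_deriv q s < student_exponent_deriv p s)"
  proof (cases q)
    case (real q')
    then have q: "p' < q'" using assms p by simp
    have "student_exponent_deriv q s - student_exponent_deriv p s =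
        (p' + 1) / (2 * (p' + s)) - (q' + 1) / (2 * (q' + s))"
      using p real by (simp add: student_exponent_deriv_def minus_divide_left[symmetric] del: minus_add_distrib)
    also have "\<dots> = (q' - p') * (1 - s) / (2 * (p' + s) * (q' + s))"
      using p q assms by (simp add: divide_simps) (simp add: algebra_simps)
    finally have *: "student_exponent_deriv q s - student_exponent_deriv p s =
        (q' - p') * (1 - s) / (2 * (p' + s) * (q' + s))" .
    have "0 < 2 * (p' + s) * (q' + s)" using p q assms by (intro mult_pos_pos) auto
    then show ?thesis using * q
      by (smt (verit) divide_pos_pos divide_neg_pos mult_pos_pos mult_pos_neg)
  next
    case PInf
    then show ?thesis using p assms
      by (auto simp: student_exponent_deriv_def divide_simps)
  qed (use assms in auto)
  then show "s < 1 \<Longrightarrow> student_exponent_deriv p s < student_exponent_deriv q s"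
    and "1 < s \<Longrightarrow> student_exponent_deriv q s < student_exponent_deriv p s" by auto
qed

text \<open>The logarithm of the ratio is, up to an additive constant, the difference of the
  exponents at \<open>x\<^sup>2\<close>, whose derivative is positive before 1 and negative after
  it. In both alternatives \<open>\<bar>y\<bar>\<close> is nearer to 1 than
  \<open>\<bar>x\<bar>\<close>, on the same side.\<close>

lemma student_density_ratio_less:
  assumes p: "0 < p" and pq: "p < q"
    and less: "\<bar>x\<bar> < \<bar>y\<bar> \<and> \<bar>y\<bar> \<le> 1 \<or> 1 \<le> \<bar>y\<bar> \<and> \<bar>y\<bar> < \<bar>x\<bar>"
  shows "student_density q x / student_density p x < student_density q y / student_density p y"
proof -
  have q: "0 < q" using p pq by auto
  let ?d = "\<lambda>s. student_exponent q s - student_exponent p s"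
  have deriv: "(?d has_real_derivative student_exponent_deriv q s - student_exponent_deriv p s) (at s)"
    if "0 \<le> s" for s
    using that by (intro DERIV_diff student_exponent_has_deriv p q)
  have sq_pos: "0 \<le> s" if "z\<^sup>2 < s" for s z :: real using that by (meson less_imp_le order_trans zero_le_power2)
  have cont: "continuous_on {a..b} ?d" if "0 \<le> a" for a b
    using that deriv by (intro continuous_at_imp_continuous_on) (meson DERIV_isCont atLeastAtMost_iff order_trans)
  have "?d (x\<^sup>2) < ?d (y\<^sup>2)"
    using less
  proof
    assume "\<bar>x\<bar> < \<bar>y\<bar> \<and> \<bar>y\<bar> \<le> 1"
    then have "x\<^sup>2 < y\<^sup>2" "y\<^sup>2 \<le> 1" by (auto simp: abs_square_le_1 abs_le_square_iff not_le[symmetric])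
    then show ?thesis
      using cont
    proof (intro DERIV_pos_imp_increasing_open[of "x\<^sup>2" "y\<^sup>2" ?d])
      show "\<exists>D. (?d has_real_derivative D) (at s) \<and> 0 < D" if "x\<^sup>2 < s" "s < y\<^sup>2" for s
        using deriv[OF sq_pos[OF that(1)]] student_exponent_deriv_less(1)[OF p pq sq_pos[OF that(1)]]
          that \<open>y\<^sup>2 \<le> 1\<close> by (intro exI conjI) auto
    qed auto
  next
    assume "1 \<le> \<bar>y\<bar> \<and> \<bar>y\<bar> < \<bar>x\<bar>"
    then have "y\<^sup>2 < x\<^sup>2" "1 \<le> y\<^sup>2"
      using abs_le_square_iff[of 1 y] by (auto simp: abs_le_square_iff not_le[symmetric])
    then show ?thesis
      using cont
    proof (intro DERIV_neg_imp_decreasing_open[of "y\<^sup>2" "x\<^sup>2" ?d])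
      show "\<exists>D. (?d has_real_derivative D) (at s) \<and> D < 0" if "y\<^sup>2 < s" "s < x\<^sup>2" for s
        using deriv[OF sq_pos[OF that(1)]] student_exponent_deriv_less(2)[OF p pq sq_pos[OF that(1)]]
          that \<open>1 \<le> y\<^sup>2\<close> by (intro exI conjI) auto
    qed auto
  qed
  then have "student_density q 0 / student_density p 0 * exp (?d (x\<^sup>2)) <
      student_density q 0 / student_density p 0 * exp (?d (y\<^sup>2))"
    by (intro mult_strict_left_mono divide_pos_pos student_density_pos p q) simp
  moreover have "student_density q z / student_density p z =
      student_density q 0 / student_density p 0 * exp (?d (z\<^sup>2))" for z
    by (subst (1 2) student_density_eq_exp) (simp_all add: p q exp_diff)
  ultimately show ?thesis by metis
qed

text \<open>By strict monotonicity in \<open>\<bar>x\<bar>\<close> on either side of 1, a level set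
  contains at most one absolute value on each side, hence at most four points.\<close>

lemma AE_student_density_ratio_neq:
  assumes p: "0 < p" and pq: "p < q"
  shows "AE x in lborel. student_density q x / student_density p x \<noteq> m"
proof -
  define Z where "Z = {x. student_density q x / student_density p x = m}"
  have abs_inj: "\<bar>x\<bar> = \<bar>y\<bar>" if "x \<in> Z" "y \<in> Z" "\<bar>x\<bar> \<le> 1 \<and> \<bar>y\<bar> \<le> 1 \<or> 1 \<le> \<bar>x\<bar> \<and> 1 \<le> \<bar>y\<bar>" for x y
    using that student_density_ratio_less[OF p pq, of x y] student_density_ratio_less[OF p pq, of y x]
    by (cases "\<bar>x\<bar>" "\<bar>y\<bar>" rule: linorder_cases) (auto simp: Z_def)
  have fin: "finite A" if "\<And>x y. x \<in> A \<Longrightarrow> y \<in> A \<Longrightarrow> \<bar>x\<bar> = \<bar>y\<bar>" for A :: "real set"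
  proof (cases "A = {}")
    case False
    then obtain z where "z \<in> A" by blast
    then have "A \<subseteq> {z, - z}" using that by (force simp: abs_eq_iff)
    then show ?thesis by (rule finite_subset) simp
  qed simp
  have "finite (Z \<inter> {x. \<bar>x\<bar> \<le> 1})" "finite (Z \<inter> {x. 1 \<le> \<bar>x\<bar>})"
    by (rule fin; use abs_inj in auto)+
  moreover have "Z = Z \<inter> {x. \<bar>x\<bar> \<le> 1} \<union> Z \<inter> {x. 1 \<le> \<bar>x\<bar>}" by auto
  ultimately have "finite Z" by (metis finite_Un)
  then have "Z \<in> null_sets lborel" by (rule finite_imp_null_set_lborel)
  then show ?thesis by (rule AE_I') (auto simp: Z_def)
qed

section \<open>Strict decrease of ratios of means\<close>

text \<open>Putting one point back into the exceptional set keeps it null. This allows passing from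
  \<open>S\<close> to \<open>S - {0}\<close>, the part of \<open>S\<close> where the indicator of
  \<open>t \<noteq> 0\<close> is nonzero.\<close>

lemma not_lambda_constant_on_remove:
  assumes "\<not> lambda_constant_on S h"
  shows "\<not> lambda_constant_on (S - {x}) h"
proof
  assume "lambda_constant_on (S - {x}) h"
  then obtain l where N: "{y \<in> S - {x}. h y \<noteq> l} \<in> null_sets lborel"
    by (auto simp: lambda_constant_on_def)
  have "{x} \<in> null_sets lborel" by (simp add: finite_imp_null_set_lborel)
  with N have "insert x {y \<in> S - {x}. h y \<noteq> l} \<in> null_sets lborel"
    by (metis null_sets.Un insert_is_Un)
  moreover have "{y \<in> S. h y \<noteq> l} = {y \<in> S - {x}. h y \<noteq> l} \<or>
      {y \<in> S. h y \<noteq> l} = insert x {y \<in> S - {x}. h y \<noteq> l}" by auto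
  ultimately have "{y \<in> S. h y \<noteq> l} \<in> null_sets lborel" using N by (elim disjE) (simp_all only:)
  with assms show False by (auto simp: lambda_constant_on_def)
qed

text \<open>
  Here \<open>\<tau>\<close> stands for one of the maps \<open>x \<mapsto> (1 - \<bar>x\<bar>)\<^sub>+\<close> and \<open>x \<mapsto> (\<bar>x\<bar> - 1)\<^sub>+\<close>, and the affine map \<open>t \<mapsto> k + c * t\<close>
  is a right inverse of it, which carries null sets on the line back to null sets in \<open>S\<close>.
\<close>
lemma student_mean_ratio_strict_antimono:
  fixes M :: "ereal \<Rightarrow> 'a measure" and T :: "ereal \<Rightarrow> 'a \<Rightarrow> real" and a r \<tau> :: "real \<Rightarrow> real"
  assumes prob: "\<And>p. 0 < p \<Longrightarrow> prob_space (M p)"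
    and dist: "\<And>p. 0 < p \<Longrightarrow> distributed (M p) lborel (T p) (\<lambda>x. ennreal (student_density p x))"
    and \<tau>_meas: "\<tau> \<in> borel_measurable borel" and \<tau>_in: "\<And>x. \<tau> x \<in> S"
    and S: "S \<in> sets borel" "S \<subseteq> {0..}"
    and \<tau>_order: "\<And>x y. 0 < \<tau> x \<Longrightarrow> 0 < \<tau> y \<Longrightarrow> \<tau> x < \<tau> y \<Longrightarrow>
      \<bar>y\<bar> < \<bar>x\<bar> \<and> \<bar>x\<bar> \<le> 1 \<or> 1 \<le> \<bar>x\<bar> \<and> \<bar>x\<bar> < \<bar>y\<bar>"
    and c: "c \<noteq> 0" and \<tau>_affine: "\<And>t. t \<in> S \<Longrightarrow> \<tau> (k + c * t) = t"
    and a_nonneg: "a \<in> S \<rightarrow> {0..}" and a_bdd: "bounded (a ` S)"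
    and a_meas: "a \<in> borel_measurable (restrict_space borel S)" and a0: "a 0 = 0"
    and r_bdd: "bounded (r ` S)" and r_mono: "mono_on S r"
    and not_const: "\<not> lambda_constant_on {t \<in> S. a t \<noteq> 0} r"
  shows "strict_antimono_on {0<..}
    (\<lambda>p. (\<integral>\<omega>. r (\<tau> (T p \<omega>)) * a (\<tau> (T p \<omega>)) \<partial>M p) / (\<integral>\<omega>. a (\<tau> (T p \<omega>)) \<partial>M p))"
proof (intro monotone_onI)
  fix p q :: ereal
  assume "p \<in> {0<..}" "q \<in> {0<..}" and pq: "p < q"
  then have p: "0 < p" and q: "0 < q" by auto
  define A where "A x = a (\<tau> x)" for x
  define R where "R x = r (\<tau> x)" for x
  define \<rho> where "\<rho> x = student_density q x / student_density p x" for x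
  \<comment> \<open>The values of \<open>a\<close> and \<open>r\<close> outside \<open>S\<close> are
    arbitrary, so compositions are formed through the subspace \<open>S\<close>.\<close>
  have \<tau>_restrict: "\<tau> \<in> borel \<rightarrow>\<^sub>M restrict_space borel S"
    using \<tau>_meas \<tau>_in by (intro measurable_restrict_space2) auto
  have A_meas[measurable]: "A \<in> borel_measurable borel"
    unfolding A_def by (rule measurable_compose[OF \<tau>_restrict a_meas])
  have r_meas: "r \<in> borel_measurable (restrict_space borel S)"
    by (rule borel_measurable_mono_on_fnc[OF r_mono])
  have R_meas[measurable]: "R \<in> borel_measurable borel"
    unfolding R_def by (rule measurable_compose[OF \<tau>_restrict r_meas])
  obtain Ba where Ba: "\<bar>A x\<bar> \<le> Ba" for x
    using a_bdd \<tau>_in by (auto simp: bounded_iff A_def)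
  obtain Br where Br: "\<bar>R x\<bar> \<le> Br" for x
    using r_bdd \<tau>_in by (auto simp: bounded_iff R_def)
  have A_nonneg: "0 \<le> A x" for x using a_nonneg \<tau>_in by (auto simp: A_def)
  \<comment> \<open>The variables for different parameters may live on different spaces; integrals
    over the line make their laws comparable.\<close>
  have mean: "(\<integral>\<omega>. g (T s \<omega>) \<partial>M s) = (\<integral>x. student_density s x * g x \<partial>lborel)"
    if "0 < s" and [measurable]: "g \<in> borel_measurable borel" for s g
    using distributed_integral[OF dist, of s g] that by (simp add: student_density_pos less_imp_le)
  have int: "integrable lborel (\<lambda>x. student_density s x * g x)"
    if "0 < s" and [measurable]: "g \<in> borel_measurable borel" and "\<And>x. \<bar>g x\<bar> \<le> B" for s g B
  proof -
    interpret prob_space "M s" by (rule prob[OF that(1)])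
    have [measurable]: "T s \<in> borel_measurable (M s)"
      using distributed_measurable[OF dist[OF that(1)]] by simp
    have "integrable (M s) (\<lambda>\<omega>. g (T s \<omega>))"
      using that(3) by (intro integrable_const_bound[of _ B]) auto
    then show ?thesis
      using distributed_integrable[OF dist, of s g] that(1,2) by (simp add: student_density_pos less_imp_le)
  qed
  have AR_bound: "\<bar>A x * R x\<bar> \<le> Ba * Br" for x
    unfolding abs_mult using Ba[of x] Br[of x] by (intro mult_mono) auto
  have AR_meas[measurable]: "(\<lambda>x. A x * R x) \<in> borel_measurable borel" by measurable
  \<comment> \<open>Tilting the weight for \<open>p\<close> by the likelihood ratio yields the
    weight for \<open>q\<close>.\<close>
  have cancel: "student_density p x * A x * \<rho> x = student_density q x * A x" for x
    using student_density_pos[OF p, of x] by (simp add: \<rho>_def)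
  have "(\<integral>x. student_density p x * A x * \<rho> x * R x \<partial>lborel) / (\<integral>x. student_density p x * A x * \<rho> x \<partial>lborel)
      < (\<integral>x. student_density p x * A x * R x \<partial>lborel) / (\<integral>x. student_density p x * A x \<partial>lborel)"
  proof (rule tilted_weighted_mean_less[where l = "- Br" and u = Br])
    show "integrable lborel (\<lambda>x. student_density p x * A x)"
      by (rule int[OF p _ Ba]) simp
    show "integrable lborel (\<lambda>x. student_density p x * A x * \<rho> x)"
      unfolding cancel by (rule int[OF q _ Ba]) simp
    show "integrable lborel (\<lambda>x. student_density p x * A x * R x)"
      unfolding mult.assoc by (rule int[OF p _ AR_bound]) simp
    show "integrable lborel (\<lambda>x. student_density p x * A x * \<rho> x * R x)"
      unfolding cancel unfolding mult.assoc by (rule int[OF q _ AR_bound]) simp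
    show "0 \<le> student_density p x * A x" for x
      using student_density_pos[OF p, of x] A_nonneg by simp
    show "0 < \<rho> x" for x
      unfolding \<rho>_def by (intro divide_pos_pos student_density_pos p q)
    show "- Br \<le> R x" "R x \<le> Br" for x using Br[of x] by auto
    show "R y \<le> R x"
      if "student_density p x * A x \<noteq> 0" "student_density p y * A y \<noteq> 0" "\<rho> x < \<rho> y" for x y
    proof -
      \<comment> \<open>Since \<open>a 0 = 0\<close>, a nonzero weight excludes
        \<open>\<tau> = 0\<close>, the value that \<open>\<tau>_order\<close> does not
        cover.\<close>
      have pos: "0 < \<tau> x" "0 < \<tau> y"
        using that a0 S(2) \<tau>_in[of x] \<tau>_in[of y] by (auto simp: A_def less_le)
      have "\<tau> y \<le> \<tau> x"
      proof (rule ccontr)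
        assume "\<not> \<tau> y \<le> \<tau> x"
        then have "\<rho> y < \<rho> x"
          using \<tau>_order[OF pos] unfolding \<rho>_def by (intro student_density_ratio_less p pq) auto
        with that(3) show False by simp
      qed
      then show ?thesis using r_mono \<tau>_in by (auto simp: R_def intro: mono_onD)
    qed
    show "AE x in lborel. student_density p x * A x \<noteq> 0 \<longrightarrow> \<rho> x \<noteq> m" for m
      using AE_student_density_ratio_neq[OF p pq, of m] by (auto simp: \<rho>_def)
    show "\<not> (AE x in lborel. student_density p x * A x \<noteq> 0 \<longrightarrow> R x = l)" for l
    proof
      assume "AE x in lborel. student_density p x * A x \<noteq> 0 \<longrightarrow> R x = l"
      then have "AE x in lborel. A x \<noteq> 0 \<longrightarrow> R x = l"
        using student_density_pos[OF p] by (auto simp: less_imp_neq[symmetric] order.strict_implies_not_eq elim!: eventually_mono)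
      then have "AE t in lborel. A (k + c * t) \<noteq> 0 \<longrightarrow> R (k + c * t) = l"
        by (intro AE_borel_affine[OF c]) auto
      then have AE: "AE t in lborel. t \<notin> {t \<in> S. a t \<noteq> 0 \<and> r t \<noteq> l}"
        by eventually_elim (auto simp: A_def R_def \<tau>_affine)
      \<comment> \<open>Membership in \<open>null_sets\<close> requires a Borel set; extending
        \<open>a\<close> and \<open>r\<close> by zero outside \<open>S\<close> shows that the
        exceptional set is one.\<close>
      have [measurable]: "(\<lambda>t. indicator S t *\<^sub>R a t) \<in> borel_measurable borel"
          "(\<lambda>t. indicator S t *\<^sub>R r t) \<in> borel_measurable borel"
        using a_meas r_meas S(1) by (auto simp: borel_measurable_restrict_space_iff)
      have "{t \<in> space borel. t \<in> S \<and> indicator S t *\<^sub>R a t \<noteq> 0 \<and> indicator S t *\<^sub>R r t \<noteq> l} \<in> sets borel"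
        using S(1) by measurable
      also have "{t \<in> space borel. t \<in> S \<and> indicator S t *\<^sub>R a t \<noteq> 0 \<and> indicator S t *\<^sub>R r t \<noteq> l} =
          {t \<in> S. a t \<noteq> 0 \<and> r t \<noteq> l}" by auto
      finally have "{t \<in> S. a t \<noteq> 0 \<and> r t \<noteq> l} \<in> null_sets lborel"
        using AE by (subst AE_iff_null_sets) auto
      with not_const show False by (auto simp: lambda_constant_on_def)
    qed
  qed
  then show "(\<integral>\<omega>. r (\<tau> (T p \<omega>)) * a (\<tau> (T p \<omega>)) \<partial>M p) / (\<integral>\<omega>. a (\<tau> (T p \<omega>)) \<partial>M p)
      > (\<integral>\<omega>. r (\<tau> (T q \<omega>)) * a (\<tau> (T q \<omega>)) \<partial>M q) / (\<integral>\<omega>. a (\<tau> (T q \<omega>)) \<partial>M q)"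
    using mean[OF p A_meas] mean[OF q A_meas] mean[OF p AR_meas] mean[OF q AR_meas]
    unfolding cancel by (simp add: A_def R_def ac_simps)
qed

section \<open>Conditional means as ratios\<close>

lemma expectation_given_eq_ratio:
  "expectation_given M (\<lambda>\<omega>. b (X \<omega>)) {\<omega> \<in> space M. X \<omega> \<noteq> 0} =
    (\<integral>\<omega>. b (X \<omega>) * of_bool (X \<omega> \<noteq> 0) \<partial>M) / (\<integral>\<omega>. of_bool (X \<omega> \<noteq> 0) \<partial>M)"
proof -
  let ?A = "{\<omega> \<in> space M. X \<omega> \<noteq> 0}"
  \<comment> \<open>If \<open>?A\<close> is not measurable, both sides take the default value
    0.\<close>
  have "measure M ?A = (\<integral>\<omega>. indicator ?A \<omega> \<partial>M)"
    by (simp add: Int_absorb2 Collect_restrict)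
  also have "\<dots> = (\<integral>\<omega>. of_bool (X \<omega> \<noteq> 0) \<partial>M)"
    by (intro Bochner_Integration.integral_cong) (auto simp: indicator_def)
  finally have "measure M ?A = (\<integral>\<omega>. of_bool (X \<omega> \<noteq> 0) \<partial>M)" .
  moreover have "set_lebesgue_integral M ?A (\<lambda>\<omega>. b (X \<omega>)) = (\<integral>\<omega>. b (X \<omega>) * of_bool (X \<omega> \<noteq> 0) \<partial>M)"
    unfolding set_lebesgue_integral_def
    by (intro Bochner_Integration.integral_cong) (auto simp: indicator_def)
  ultimately show ?thesis by (simp add: expectation_given_def)
qed

text \<open>Conditioning on \<open>\<tau> \<noteq> 0\<close> is weighting by the indicator of
  \<open>t \<noteq> 0\<close>, so the ratio result applies with that indicator as \<open>a\<close>
  and with \<open>r = b\<close>.\<close>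

lemma student_conditional_mean_strict_antimono:
  fixes M :: "ereal \<Rightarrow> 'a measure" and T :: "ereal \<Rightarrow> 'a \<Rightarrow> real" and b \<tau> :: "real \<Rightarrow> real"
  assumes "\<And>p. 0 < p \<Longrightarrow> prob_space (M p)"
    and "\<And>p. 0 < p \<Longrightarrow> distributed (M p) lborel (T p) (\<lambda>x. ennreal (student_density p x))"
    and "\<tau> \<in> borel_measurable borel" and \<tau>_in: "\<And>x. \<tau> x \<in> S"
    and S: "S \<in> sets borel" "S \<subseteq> {0..}"
    and "\<And>x y. 0 < \<tau> x \<Longrightarrow> 0 < \<tau> y \<Longrightarrow> \<tau> x < \<tau> y \<Longrightarrow>
      \<bar>y\<bar> < \<bar>x\<bar> \<and> \<bar>x\<bar> \<le> 1 \<or> 1 \<le> \<bar>x\<bar> \<and> \<bar>x\<bar> < \<bar>y\<bar>"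
    and "c \<noteq> 0" and "\<And>t. t \<in> S \<Longrightarrow> \<tau> (k + c * t) = t"
    and "bounded (b ` S)" and "mono_on S b" and not_const: "\<not> lambda_constant_on S b"
  shows "strict_antimono_on {0<..}
    (\<lambda>p. expectation_given (M p) (\<lambda>\<omega>. b (\<tau> (T p \<omega>))) {\<omega> \<in> space (M p). \<tau> (T p \<omega>) \<noteq> 0})"
proof -
  have "strict_antimono_on {0<..}
    (\<lambda>p. (\<integral>\<omega>. b (\<tau> (T p \<omega>)) * of_bool (\<tau> (T p \<omega>) \<noteq> 0) \<partial>M p) / (\<integral>\<omega>. of_bool (\<tau> (T p \<omega>) \<noteq> 0) \<partial>M p))"
  proof (rule student_mean_ratio_strict_antimono[where a = "\<lambda>t. of_bool (t \<noteq> 0)" and \<tau> = \<tau> and T = T and S = S and c = c and k = k])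
    have "\<not> lambda_constant_on (S - {0}) b" using not_const by (rule not_lambda_constant_on_remove)
    also have "S - {0} = {t \<in> S. of_bool (t \<noteq> 0) \<noteq> (0::real)}" by auto
    finally show "\<not> lambda_constant_on {t \<in> S. of_bool (t \<noteq> 0) \<noteq> (0::real)} b" .
    show "bounded ((\<lambda>t. of_bool (t \<noteq> 0) :: real) ` S)" by (auto simp: bounded_iff intro!: exI[of _ 1])
    show "(\<lambda>t. of_bool (t \<noteq> 0) :: real) \<in> borel_measurable (restrict_space borel S)"
      by (intro measurable_restrict_space1) measurable
  qed (use assms in simp_all)
  then show ?thesis by (simp only: expectation_given_eq_ratio[where b = b])
qed

lemma expectation_given_cong:
  assumes "A = B" and "\<And>\<omega>. \<omega> \<in> A \<Longrightarrow> X \<omega> = Y \<omega>"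
  shows "expectation_given M X A = expectation_given M Y B"
  unfolding expectation_given_def set_lebesgue_integral_def assms(1)[symmetric]
  using assms(2) by (auto intro!: arg_cong2[of _ _ _ _ "(/)"] Bochner_Integration.integral_cong simp: indicator_def)


section \<open>The four monotonicity statements\<close>

theorem proposition1p4:
  fixes M :: "ereal \<Rightarrow> 'a measure" and T :: "ereal \<Rightarrow> 'a \<Rightarrow> real"
  assumes "\<And>p. 0 < p \<Longrightarrow> prob_space (M p)"
    and "\<And>p. 0 < p \<Longrightarrow> distributed (M p) lborel (T p) (\<lambda>x. ennreal (student_density p x))"
  shows
    "(\<forall>b :: real \<Rightarrow> real.
        b \<in> {0..1} \<rightarrow> {0..} \<longrightarrow> mono_on {0..1} b \<longrightarrow> \<not> lambda_constant_on {0..1} b \<longrightarrow>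
        strict_antimono_on {0<..}
          (\<lambda>p. expectation_given (M p) (\<lambda>\<omega>. b (1 - \<bar>T p \<omega>\<bar>)) {\<omega> \<in> space (M p). \<bar>T p \<omega>\<bar> < 1}))
   \<and> (\<forall>b :: real \<Rightarrow> real.
        b \<in> {0..} \<rightarrow> {0..} \<longrightarrow> bounded (b ` {0..}) \<longrightarrow> mono_on {0..} b \<longrightarrow>
        \<not> lambda_constant_on {0..} b \<longrightarrow>
        strict_antimono_on {0<..}
          (\<lambda>p. expectation_given (M p) (\<lambda>\<omega>. b (\<bar>T p \<omega>\<bar> - 1)) {\<omega> \<in> space (M p). \<bar>T p \<omega>\<bar> > 1}))
   \<and> (\<forall>a r b :: real \<Rightarrow> real.
        a \<in> {0..1} \<rightarrow> {0..} \<longrightarrow> bounded (a ` {0..1}) \<longrightarrow>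
        a \<in> borel_measurable (restrict_space borel {0..1}) \<longrightarrow> a 0 = 0 \<longrightarrow>
        r \<in> {0..1} \<rightarrow> {0..} \<longrightarrow> mono_on {0..1} r \<longrightarrow>
        \<not> lambda_constant_on {t \<in> {0..1}. a t \<noteq> 0} r \<longrightarrow>
        (\<forall>t\<in>{0..1}. b t = r t * a t) \<longrightarrow>
        strict_antimono_on {0<..}
          (\<lambda>p. (\<integral>\<omega>. b (max 0 (1 - \<bar>T p \<omega>\<bar>)) \<partial>M p) / (\<integral>\<omega>. a (max 0 (1 - \<bar>T p \<omega>\<bar>)) \<partial>M p)))
   \<and> (\<forall>a r b :: real \<Rightarrow> real.
        a \<in> {0..} \<rightarrow> {0..} \<longrightarrow> bounded (a ` {0..}) \<longrightarrow>
        a \<in> borel_measurable (restrict_space borel {0..}) \<longrightarrow> a 0 = 0 \<longrightarrow>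
        r \<in> {0..} \<rightarrow> {0..} \<longrightarrow> bounded (r ` {0..}) \<longrightarrow> mono_on {0..} r \<longrightarrow>
        \<not> lambda_constant_on {t \<in> {0..}. a t \<noteq> 0} r \<longrightarrow>
        (\<forall>t\<in>{0..}. b t = r t * a t) \<longrightarrow>
        strict_antimono_on {0<..}
          (\<lambda>p. (\<integral>\<omega>. b (max 0 (\<bar>T p \<omega>\<bar> - 1)) \<partial>M p) / (\<integral>\<omega>. a (max 0 (\<bar>T p \<omega>\<bar> - 1)) \<partial>M p)))"
proof (intro conjI allI impI)
  \<comment> \<open>Right inverses are \<open>1 - t\<close> on \<open>{0..1}\<close> and
    \<open>1 + t\<close> on \<open>{0..}\<close>, whence \<open>k = 1\<close> and
    \<open>c = - 1\<close> or \<open>c = 1\<close> below.\<close>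
  let ?\<tau> = "\<lambda>x::real. max 0 (1 - \<bar>x\<bar>)" and ?\<upsilon> = "\<lambda>x::real. max 0 (\<bar>x\<bar> - 1)"
  have bdd: "bounded (h ` {0..1})" if "mono_on {0..1} h" for h :: "real \<Rightarrow> real"
    by (intro bounded_subset[OF bounded_closed_interval[of "h 0" "h 1"]])
      (auto intro!: mono_onD[OF that])
  {
    fix b :: "real \<Rightarrow> real"
    assume b: "mono_on {0..1} b" "\<not> lambda_constant_on {0..1} b"
    have "strict_antimono_on {0<..} (\<lambda>p. expectation_given (M p) (\<lambda>\<omega>. b (?\<tau> (T p \<omega>)))
        {\<omega> \<in> space (M p). ?\<tau> (T p \<omega>) \<noteq> 0})"
      by (rule student_conditional_mean_strict_antimono[where T = T and \<tau> = "?\<tau>" and S = "{0..1}" and c = "- 1" and k = 1])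
        (use assms b bdd in \<open>auto split: if_splits simp: max_def\<close>)
    \<comment> \<open>On the conditioning event the truncation at 0 is inactive.\<close>
    also have "(\<lambda>p. expectation_given (M p) (\<lambda>\<omega>. b (?\<tau> (T p \<omega>))) {\<omega> \<in> space (M p). ?\<tau> (T p \<omega>) \<noteq> 0}) =
        (\<lambda>p. expectation_given (M p) (\<lambda>\<omega>. b (1 - \<bar>T p \<omega>\<bar>)) {\<omega> \<in> space (M p). \<bar>T p \<omega>\<bar> < 1})"
      by (intro ext expectation_given_cong) (auto simp: max_def)
    finally show "strict_antimono_on {0<..}
        (\<lambda>p. expectation_given (M p) (\<lambda>\<omega>. b (1 - \<bar>T p \<omega>\<bar>)) {\<omega> \<in> space (M p). \<bar>T p \<omega>\<bar> < 1})" .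
  }
  {
    fix b :: "real \<Rightarrow> real"
    assume b: "bounded (b ` {0..})" "mono_on {0..} b" "\<not> lambda_constant_on {0..} b"
    have "strict_antimono_on {0<..} (\<lambda>p. expectation_given (M p) (\<lambda>\<omega>. b (?\<upsilon> (T p \<omega>)))
        {\<omega> \<in> space (M p). ?\<upsilon> (T p \<omega>) \<noteq> 0})"
      by (rule student_conditional_mean_strict_antimono[where T = T and \<tau> = "?\<upsilon>" and S = "{0..}" and c = 1 and k = 1])
        (use assms b in \<open>auto split: if_splits simp: max_def\<close>)
    also have "(\<lambda>p. expectation_given (M p) (\<lambda>\<omega>. b (?\<upsilon> (T p \<omega>))) {\<omega> \<in> space (M p). ?\<upsilon> (T p \<omega>) \<noteq> 0}) =
        (\<lambda>p. expectation_given (M p) (\<lambda>\<omega>. b (\<bar>T p \<omega>\<bar> - 1)) {\<omega> \<in> space (M p). \<bar>T p \<omega>\<bar> > 1})"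
      by (intro ext expectation_given_cong) (auto simp: max_def)
    finally show "strict_antimono_on {0<..}
        (\<lambda>p. expectation_given (M p) (\<lambda>\<omega>. b (\<bar>T p \<omega>\<bar> - 1)) {\<omega> \<in> space (M p). \<bar>T p \<omega>\<bar> > 1})" .
  }
  {
    fix a r b :: "real \<Rightarrow> real"
    assume a: "a \<in> {0..1} \<rightarrow> {0..}" "bounded (a ` {0..1})"
        "a \<in> borel_measurable (restrict_space borel {0..1})" "a 0 = 0"
      and r: "mono_on {0..1} r" "\<not> lambda_constant_on {t \<in> {0..1}. a t \<noteq> 0} r"
      and b: "\<forall>t\<in>{0..1}. b t = r t * a t"
    have "strict_antimono_on {0<..}
        (\<lambda>p. (\<integral>\<omega>. r (?\<tau> (T p \<omega>)) * a (?\<tau> (T p \<omega>)) \<partial>M p) / (\<integral>\<omega>. a (?\<tau> (T p \<omega>)) \<partial>M p))"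
      by (rule student_mean_ratio_strict_antimono[where T = T and \<tau> = "?\<tau>" and S = "{0..1}" and c = "- 1" and k = 1])
        (use assms a r bdd in \<open>auto split: if_splits simp: max_def\<close>)
    \<comment> \<open>The identity for \<open>b\<close> is known only on \<open>{0..1}\<close>,
      which contains every value of \<open>?\<tau>\<close>.\<close>
    then show "strict_antimono_on {0<..}
        (\<lambda>p. (\<integral>\<omega>. b (?\<tau> (T p \<omega>)) \<partial>M p) / (\<integral>\<omega>. a (?\<tau> (T p \<omega>)) \<partial>M p))"
      using b by simp
  }
  {
    fix a r b :: "real \<Rightarrow> real"
    assume a: "a \<in> {0..} \<rightarrow> {0..}" "bounded (a ` {0..})"
        "a \<in> borel_measurable (restrict_space borel {0..})" "a 0 = 0"
      and r: "bounded (r ` {0..})" "mono_on {0..} r" "\<not> lambda_constant_on {t \<in> {0..}. a t \<noteq> 0} r"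
      and b: "\<forall>t\<in>{0..}. b t = r t * a t"
    have "strict_antimono_on {0<..}
        (\<lambda>p. (\<integral>\<omega>. r (?\<upsilon> (T p \<omega>)) * a (?\<upsilon> (T p \<omega>)) \<partial>M p) / (\<integral>\<omega>. a (?\<upsilon> (T p \<omega>)) \<partial>M p))"
      by (rule student_mean_ratio_strict_antimono[where T = T and \<tau> = "?\<upsilon>" and S = "{0..}" and c = 1 and k = 1])
        (use assms a r in \<open>auto split: if_splits simp: max_def\<close>)
    then show "strict_antimono_on {0<..}
        (\<lambda>p. (\<integral>\<omega>. b (?\<upsilon> (T p \<omega>)) \<partial>M p) / (\<integral>\<omega>. a (?\<upsilon> (T p \<omega>)) \<partial>M p))"
      using b by simp
  }
qed

end
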